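(* Let $R$ be a commutative associative unital ring with $\frac12,\frac13\in R$. Then any $R$-algebra automorphism $\theta$ of $W(2)_R$ maps each of the left ideals $\bigoplus_{i=1}^4Re_i$, $\bigoplus_{i=1}^6Re_i$, $Re_5\oplus Re_6$ and $Re_7\oplus Re_8$ onto itself. Relative to the basis $e_1,\dots,e_8$ the matrix of an automorphism is of the form $$\begin{pmatrix} 1&0&2tx&3t^2x^2&0&0&0&0\\ x&\frac1t&tx^2&t^2x^3&0&0&0&0\\ 0&0&t&3t^2x&0&0&0&0\\ 0&0&0&t^2&0&0&0&0\\ 0&0&0&0&1&-tx&0&0\\ 0&0&0&0&0&t&0&0\\ 0&0&0&0&0&0&t&0\\ 0&0&0&0&0&0&tx&1 \end{pmatrix}$$ with $x\in R$ and $t\in R^\times$.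
   Context: $W(2)_R=\bigoplus_{i=1}^8Re_i$ is the (non-associative) $R$-algebra, free as an $R$-module with basis $e_1,\dots,e_8$, with $R$-bilinear product given by (zero products omitted): $e_1e_1=-e_1$, $e_1e_2=-3e_2$, $e_1e_3=e_3$, $e_1e_4=3e_4$, $e_1e_5=-e_5$, $e_1e_6=e_6$, $e_1e_7=e_7$, $e_1e_8=-e_8$; $e_2e_1=3e_2$, $e_2e_3=2e_1$, $e_2e_4=e_3$, $e_2e_6=-e_5$, $e_2e_7=e_8$; $e_3e_1=-2e_3$, $e_3e_2=-e_1$, $e_3e_3=-3e_4$, $e_3e_5=e_6$, $e_3e_8=-e_7$; $e_5e_1=-2e_1$, $e_5e_2=-3e_2$, $e_5e_3=-e_3$, $e_5e_5=-2e_5$, $e_5e_6=-e_6$, $e_5e_7=-e_7$, $e_5e_8=-2e_8$; $e_6e_1=2e_3$, $e_6e_2=e_1$, $e_6e_3=3e_4$, $e_6e_5=-e_6$, $e_6e_8=e_7$; $e_7e_1=2e_3$, $e_7e_2=e_1$, $e_7e_3=3e_4$, $e_7e_5=-e_6$, $e_7e_8=e_7$; $e_8e_2=e_2$, $e_8e_3=-e_3$, $e_8e_4=-2e_4$, $e_8e_6=-e_6$, $e_8e_7=-e_7$. Matrix convention: the $i$-th row of the matrix of a linear map $\theta$ consists of the coordinates of $\theta(e_i)$ in the basis. $R^\times$ is the group of units of $R$. *)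

theory Defs
  imports "HOL-Analysis.Cartesian_Space"
begin

(* The class comm_ring_1 demands 0 \<noteq> 1. This class does not, so the zero ring is covered as well. *)
class comm_unital_ring = comm_ring + comm_monoid_mult
begin

subclass semiring_numeral ..

subclass neg_numeral ..

end

subclass (in comm_ring_1) comm_unital_ring ..

(* The free module with basis e_1, ..., e_8 is 'a ^ 8 with e_i = axis i 1. The index type 8 has the
   elements 1, ..., 8, where 8 = 0, and the function vector fills the positions in the order
   1, ..., 8. *)

(* W2_table $ i $ j is the product of e_i and e_j *)
definition W2_table :: "'a::comm_unital_ring ^ 8 ^ 8 ^ 8" where
  "W2_table =
    (let e = (\<lambda>i. axis i 1) in vector [
      vector [- e 1, (-3) *s e 2, e 3, 3 *s e 4, - e 5, e 6, e 7, - e 8],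
      vector [3 *s e 2, 0, 2 *s e 1, e 3, 0, - e 5, e 8, 0],
      vector [(-2) *s e 3, - e 1, (-3) *s e 4, 0, e 6, 0, 0, - e 7],
      vector [0, 0, 0, 0, 0, 0, 0, 0],
      vector [(-2) *s e 1, (-3) *s e 2, - e 3, 0, (-2) *s e 5, - e 6, - e 7, (-2) *s e 8],
      vector [2 *s e 3, e 1, 3 *s e 4, 0, - e 6, 0, 0, e 7],
      vector [2 *s e 3, e 1, 3 *s e 4, 0, - e 6, 0, 0, e 7],
      vector [0, e 2, - e 3, (-2) *s e 4, 0, - e 6, - e 7, 0]])"

(* unlike times on the type 'a ^ 8, this is not componentwise *)
definition W2_mult :: "'a::comm_unital_ring ^ 8 \<Rightarrow> 'a ^ 8 \<Rightarrow> 'a ^ 8" where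
  "W2_mult v w = (\<Sum>i\<in>UNIV. \<Sum>j\<in>UNIV. (v $ i * w $ j) *s (W2_table $ i $ j))"

(* automorphisms of a nonunital algebra, so there is no condition on a unit *)
definition W2_automorphism :: "('a::comm_unital_ring ^ 8 \<Rightarrow> 'a ^ 8) \<Rightarrow> bool" where
  "W2_automorphism \<theta> \<longleftrightarrow>
    bij \<theta> \<and>
    (\<forall>v w. \<theta> (v + w) = \<theta> v + \<theta> w) \<and>
    (\<forall>r v. \<theta> (r *s v) = r *s \<theta> v) \<and>
    (\<forall>v w. \<theta> (W2_mult v w) = W2_mult (\<theta> v) (\<theta> w))"

definition W2_left_ideal :: "('a::comm_unital_ring ^ 8) set \<Rightarrow> bool" where
  "W2_left_ideal I \<longleftrightarrow>
    0 \<in> I \<and>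
    (\<forall>v\<in>I. \<forall>w\<in>I. v + w \<in> I) \<and>
    (\<forall>r. \<forall>v\<in>I. r *s v \<in> I) \<and>
    (\<forall>w. \<forall>v\<in>I. W2_mult w v \<in> I)"

definition coord_submodule :: "8 set \<Rightarrow> ('a::comm_unital_ring ^ 8) set" where
  "coord_submodule S = {(\<Sum>i\<in>S. c i *s axis i 1) | c. True}"

(* the rows are the images of the basis vectors, whereas the library function matrix
   puts them in the columns *)
definition row_matrix :: "('a::comm_unital_ring ^ 8 \<Rightarrow> 'a ^ 8) \<Rightarrow> 'a ^ 8 ^ 8" where
  "row_matrix \<theta> = (\<chi> i. \<theta> (axis i 1))"

end

theory Submission
  imports Defs
begin

text \<open>
  Write $L_v$ and $R_v$ for left and right multiplication by $v$. An automorphism \<open>\<theta>\<close> conjugates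
  $L_v$ into $L_{\theta v}$ and $R_v$ into $R_{\theta v}$, so the two linear forms
  $\mathrm{tr}\,L_v = -12 v_5 - 4 v_8$ and $\mathrm{tr}\,R_v = -3 v_5 + v_8$ are invariant under
  \<open>\<theta>\<close>. Their coefficient matrix has determinant $-24$, a unit by assumption, so the coordinates
  $v_5$ and $v_8$ themselves are invariant (\<open>automorphism_fixes_coordinates\<close>).

  The rest follows by composing these invariant forms with the product. As $(vw)_5$ and $v_5$ are
  invariant, so is the bilinear form $v_1 w_5 + v_2 w_6$; as $(vw)_8$ and $v_8$ are, so is
  $v_1 w_8 - v_2 w_7$. Substituting basis vectors into these two forms shows that
  $t = \theta(e_6)_6$ is a unit, and that $t$ and $x = -t^{-1} \theta(e_5)_6$ determine the
  coordinates 1, 2, 6 and 7 of \<open>\<theta> v\<close>. Finally \<open>\<theta>\<close> is known on the first coordinate of $e_2 w$, which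
  involves $w_3$, and then on the third coordinate of $e_2 w$, which involves $w_4$; this gives the
  two missing coordinates (\<open>automorphism_is_torus_exp\<close>).

  The resulting formulas show that \<open>\<theta>\<close> maps each of the four ideals into itself. It maps them
  onto themselves because the inverse of \<open>\<theta>\<close> is an automorphism too, to which the same applies.
\<close>

section \<open>Vectors with eight coordinates\<close>

lemma exhaust_8:
  fixes x :: 8
  shows "x = 1 \<or> x = 2 \<or> x = 3 \<or> x = 4 \<or> x = 5 \<or> x = 6 \<or> x = 7 \<or> x = 8"
proof (induct x)
  case (of_int z)
  then have "z = 0 \<or> z = 1 \<or> z = 2 \<or> z = 3 \<or> z = 4 \<or> z = 5 \<or> z = 6 \<or> z = 7" by fastforce
  then show ?case by auto
qed

lemma forall_8:
  "(\<forall>i::8. P i) \<longleftrightarrow> P 1 \<and> P 2 \<and> P 3 \<and> P 4 \<and> P 5 \<and> P 6 \<and> P 7 \<and> P 8"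
  by (metis exhaust_8)

lemma UNIV_8: "UNIV = {1, 2, 3, 4, 5, 6, 7, 8::8}"
  using exhaust_8 by auto

lemma sum_8: "sum f (UNIV::8 set) = f 1 + f 2 + f 3 + f 4 + f 5 + f 6 + f 7 + f 8"
  unfolding UNIV_8 by (simp add: ac_simps)

lemma vector_8 [simp]:
  "(vector [a,b,c,d,e,f,g,h] :: ('a::zero)^8) $ 1 = a"
  "(vector [a,b,c,d,e,f,g,h] :: ('a::zero)^8) $ 2 = b"
  "(vector [a,b,c,d,e,f,g,h] :: ('a::zero)^8) $ 3 = c"
  "(vector [a,b,c,d,e,f,g,h] :: ('a::zero)^8) $ 4 = d"
  "(vector [a,b,c,d,e,f,g,h] :: ('a::zero)^8) $ 5 = e"
  "(vector [a,b,c,d,e,f,g,h] :: ('a::zero)^8) $ 6 = f"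
  "(vector [a,b,c,d,e,f,g,h] :: ('a::zero)^8) $ 7 = g"
  "(vector [a,b,c,d,e,f,g,h] :: ('a::zero)^8) $ 8 = h"
  unfolding vector_def by simp_all

section \<open>Linear maps and the trace\<close>

definition linear_endo :: "('a::comm_unital_ring ^ 'n \<Rightarrow> 'a ^ 'n) \<Rightarrow> bool" where
  "linear_endo f \<longleftrightarrow> (\<forall>v w. f (v + w) = f v + f w) \<and> (\<forall>r v. f (r *s v) = r *s f v)"

lemma linear_endo_sum:
  assumes "linear_endo f"
  shows "f (sum g A) = (\<Sum>i\<in>A. f (g i))"
proof -
  have "f 0 + f 0 = f 0"
    using assms unfolding linear_endo_def by (metis add.right_neutral)
  then have "f 0 = 0" by simp
  then show ?thesis
    using assms by (induction A rule: infinite_finite_induct) (auto simp: linear_endo_def)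
qed

lemma linear_endo_comp:
  "linear_endo f \<Longrightarrow> linear_endo g \<Longrightarrow> linear_endo (f \<circ> g)"
  by (simp add: linear_endo_def)

lemma linear_endo_inv:
  assumes "linear_endo f" "bij f"
  shows "linear_endo (inv f)"
  unfolding linear_endo_def
proof (intro conjI allI)
  have f_inv: "f (inv f v) = v" for v
    using assms(2) by (simp add: bij_is_surj surj_f_inv_f)
  have inv_eqI: "inv f v = w" if "f w = v" for v w
    using that assms(2) by (auto simp: bij_is_inj)
  show "inv f (v + w) = inv f v + inv f w" for v w
    using assms(1) by (intro inv_eqI) (simp add: linear_endo_def f_inv)
  show "inv f (r *s v) = r *s inv f v" for r v
    using assms(1) by (intro inv_eqI) (simp add: linear_endo_def f_inv)
qed

lemma sum_unit_vectors:
  fixes v :: "'a::comm_unital_ring ^ 'n"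
  shows "(\<Sum>i\<in>UNIV. v $ i *s axis i 1) = v"
  by (simp add: vec_eq_iff axis_def if_distrib[where f = "\<lambda>x. _ * x"] cong: if_cong)

lemma linear_endo_nth:
  assumes "linear_endo f"
  shows "f v $ j = (\<Sum>i\<in>UNIV. v $ i * f (axis i 1) $ j)"
proof -
  have "f v = f (\<Sum>i\<in>UNIV. v $ i *s axis i 1)"
    by (simp only: sum_unit_vectors)
  also have "\<dots> = (\<Sum>i\<in>UNIV. v $ i *s f (axis i 1))"
    using assms by (simp add: linear_endo_sum) (simp add: linear_endo_def)
  finally show ?thesis by simp
qed

definition endo_trace :: "('a::comm_unital_ring ^ 'n \<Rightarrow> 'a ^ 'n) \<Rightarrow> 'a" where
  "endo_trace f = (\<Sum>i\<in>UNIV. f (axis i 1) $ i)"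

lemma endo_trace_comp_commute:
  assumes "linear_endo f" "linear_endo g"
  shows "endo_trace (f \<circ> g) = endo_trace (g \<circ> f)"
proof -
  have "endo_trace (f \<circ> g) = (\<Sum>i\<in>UNIV. \<Sum>j\<in>UNIV. g (axis i 1) $ j * f (axis j 1) $ i)"
    by (simp add: endo_trace_def linear_endo_nth[OF assms(1), of "g _"])
  also have "\<dots> = (\<Sum>j\<in>UNIV. \<Sum>i\<in>UNIV. f (axis j 1) $ i * g (axis i 1) $ j)"
    by (subst sum.swap) (simp add: mult.commute)
  also have "\<dots> = endo_trace (g \<circ> f)"
    by (simp add: endo_trace_def linear_endo_nth[OF assms(2), of "f _"])
  finally show ?thesis .
qed

lemma endo_trace_conjugate:
  assumes "linear_endo \<theta>" "bij \<theta>" "linear_endo f" and intertwines: "\<theta> \<circ> f = g \<circ> \<theta>"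
  shows "endo_trace g = endo_trace f"
proof -
  have "g = (\<theta> \<circ> f) \<circ> inv \<theta>"
    using assms(2) by (simp add: intertwines fun_eq_iff bij_is_surj surj_f_inv_f)
  then have "endo_trace g = endo_trace ((\<theta> \<circ> f) \<circ> inv \<theta>)"
    by simp
  also have "\<dots> = endo_trace (inv \<theta> \<circ> (\<theta> \<circ> f))"
    using assms(1-3) by (intro endo_trace_comp_commute linear_endo_comp linear_endo_inv)
  also have "inv \<theta> \<circ> (\<theta> \<circ> f) = f"
    using assms(2) by (simp add: fun_eq_iff bij_is_inj)
  finally show ?thesis .
qed

section \<open>The algebra and its invariant coordinates\<close>

lemma W2_mult_nth:
  fixes v w :: "'a::comm_unital_ring ^ 8"
  shows "W2_mult v w $ 1 = - (v$1 * w$1) + 2 * (v$2 * w$3) - v$3 * w$2 - 2 * (v$5 * w$1)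
            + v$6 * w$2 + v$7 * w$2"
    and "W2_mult v w $ 2 = - 3 * (v$1 * w$2) + 3 * (v$2 * w$1) - 3 * (v$5 * w$2) + v$8 * w$2"
    and "W2_mult v w $ 3 = v$1 * w$3 + v$2 * w$4 - 2 * (v$3 * w$1) - v$5 * w$3
            + 2 * (v$6 * w$1) + 2 * (v$7 * w$1) - v$8 * w$3"
    and "W2_mult v w $ 4 = 3 * (v$1 * w$4) - 3 * (v$3 * w$3) + 3 * (v$6 * w$3)
            + 3 * (v$7 * w$3) - 2 * (v$8 * w$4)"
    and "W2_mult v w $ 5 = - (v$1 * w$5) - v$2 * w$6 - 2 * (v$5 * w$5)"
    and "W2_mult v w $ 6 = v$1 * w$6 + v$3 * w$5 - v$5 * w$6 - v$6 * w$5 - v$7 * w$5 - v$8 * w$6"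
    and "W2_mult v w $ 7 = v$1 * w$7 - v$3 * w$8 - v$5 * w$7 + v$6 * w$8 + v$7 * w$8 - v$8 * w$7"
    and "W2_mult v w $ 8 = - (v$1 * w$8) + v$2 * w$7 - 2 * (v$5 * w$8)"
  unfolding W2_mult_def sum_8 W2_table_def Let_def vector_8
  by (simp_all add: axis_def algebra_simps)

lemma linear_endo_W2_mult_left: "linear_endo (W2_mult v)"
  by (auto simp: linear_endo_def vec_eq_iff W2_mult_def sum_distrib_left sum.distrib algebra_simps)

lemma linear_endo_W2_mult_right: "linear_endo (\<lambda>w. W2_mult w v)"
  by (auto simp: linear_endo_def vec_eq_iff W2_mult_def sum_distrib_left sum.distrib algebra_simps)

text \<open>With these equations, identities with numerals are turned into identities between sums, which
  cancellation in additive groups can prove in rings where $0 = 1$ is possible.\<close>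

lemma numeral_multiples:
  fixes z :: "'a::comm_unital_ring"
  shows "2 * z = z + z" "3 * z = z + z + z" "4 * z = z + z + z + z" "12 * z = 4 * z + 4 * z + 4 * z"
proof -
  show "2 * z = z + z" by (rule mult_2)
  show "3 * z = z + z + z" using distrib_right[of 2 1 z] by (simp add: mult_2)
  show "4 * z = z + z + z + z" using distrib_right[of 2 2 z] by (simp add: mult_2 add.assoc)
  show "12 * z = 4 * z + 4 * z + 4 * z"
    using distrib_right[of 4 8 z] distrib_right[of 4 4 z] by (simp add: add.assoc)
qed

lemma numeral_multiples_right:
  fixes z :: "'a::comm_unital_ring"
  shows "z * 2 = z + z" "z * 3 = z + z + z" "z * 4 = z + z + z + z" "z * 12 = z * 4 + z * 4 + z * 4"
  using numeral_multiples[of z] by (simp_all only: mult.commute[of z])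

lemma endo_trace_W2_mult_left: "endo_trace (W2_mult v) = - 12 * v $ 5 - 4 * v $ 8"
  by (simp add: endo_trace_def sum_8 W2_mult_nth axis_def,
      simp only: numeral_multiples numeral_multiples_right mult_minus_left mult_minus_right, simp)

lemma endo_trace_W2_mult_right: "endo_trace (\<lambda>w. W2_mult w v) = - 3 * v $ 5 + v $ 8"
  by (simp add: endo_trace_def sum_8 W2_mult_nth axis_def,
      simp only: numeral_multiples numeral_multiples_right mult_minus_left mult_minus_right, simp)

lemma W2_automorphismD:
  assumes "W2_automorphism \<theta>"
  shows "bij \<theta>" "linear_endo \<theta>" "\<theta> (W2_mult v w) = W2_mult (\<theta> v) (\<theta> w)"
  using assms by (auto simp: W2_automorphism_def linear_endo_def)

lemma W2_automorphism_inv: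
  assumes "W2_automorphism \<theta>"
  shows "W2_automorphism (inv \<theta>)"
proof -
  note \<theta> = W2_automorphismD[OF assms]
  have "inv \<theta> (W2_mult v w) = W2_mult (inv \<theta> v) (inv \<theta> w)" for v w
    using \<theta> by (metis bij_inv_eq_iff)
  then show ?thesis
    using linear_endo_inv[OF \<theta>(2,1)] bij_imp_bij_inv[OF \<theta>(1)]
    by (simp add: W2_automorphism_def linear_endo_def)
qed

lemma unit_mult_left_cancel:
  fixes u :: "'a::comm_unital_ring"
  assumes "u * h = 1" "u * a = u * b"
  shows "a = b"
proof -
  have "h * (u * a) = h * (u * b)" by (simp only: assms(2))
  then have "(u * h) * a = (u * h) * b" by (simp only: ac_simps)
  then show ?thesis by (simp add: assms(1))
qed

text \<open>The traces of left and right multiplication are invariant under conjugation by \<open>\<theta>\<close>. Adding four times the second to the first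
  leaves only $-24 v_5$, and 24 is a product of the invertible numbers 2 and 3.\<close>

lemma automorphism_fixes_coordinates:
  fixes \<theta> :: "'a::comm_unital_ring ^ 8 \<Rightarrow> 'a ^ 8"
  assumes half: "(2::'a) * h2 = 1" and third: "(3::'a) * h3 = 1" and "W2_automorphism \<theta>"
  shows "\<theta> v $ 5 = v $ 5" "\<theta> v $ 8 = v $ 8"
proof -
  note \<theta> = W2_automorphismD[OF assms(3)]
  have "endo_trace (W2_mult (\<theta> v)) = endo_trace (W2_mult v)"
    using \<theta> by (intro endo_trace_conjugate[of \<theta>] linear_endo_W2_mult_left) auto
  then have left: "- 12 * \<theta> v $ 5 - 4 * \<theta> v $ 8 = - 12 * v $ 5 - 4 * v $ 8"
    by (simp only: endo_trace_W2_mult_left)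
  have "endo_trace (\<lambda>w. W2_mult w (\<theta> v)) = endo_trace (\<lambda>w. W2_mult w v)"
    using \<theta> by (intro endo_trace_conjugate[of \<theta>] linear_endo_W2_mult_right) auto
  then have right: "- 3 * \<theta> v $ 5 + \<theta> v $ 8 = - 3 * v $ 5 + v $ 8"
    by (simp only: endo_trace_W2_mult_right)
  have elim: "2 * (2 * (2 * (3 * a))) = - (- 12 * a - 4 * b) - 2 * (2 * (- 3 * a + b))" for a b :: 'a
    by (simp only: numeral_multiples numeral_multiples_right mult_minus_left mult_minus_right) simp
  have "2 * (2 * (2 * (3 * \<theta> v $ 5))) = 2 * (2 * (2 * (3 * v $ 5)))"
    by (simp only: elim[of "\<theta> v $ 5" "\<theta> v $ 8"] elim[of "v $ 5" "v $ 8"] left right)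
  then show eq5: "\<theta> v $ 5 = v $ 5"
    by (blast dest: unit_mult_left_cancel[OF half] unit_mult_left_cancel[OF third])
  show "\<theta> v $ 8 = v $ 8" using right by (simp add: eq5)
qed

section \<open>The shape of an automorphism\<close>

text \<open>This is the exponential series of the nilpotent derivation $x L_{e_6}$, followed by the diagonal
  map with the entries $1, u, t, t^2, 1, t, t, 1$. The factorials in the series divide the entries of
  the powers of $L_{e_6}$, so the quotients are written out as integers.\<close>

definition torus_exp :: "'a \<Rightarrow> 'a \<Rightarrow> 'a \<Rightarrow> 'a::comm_unital_ring ^ 8 \<Rightarrow> 'a ^ 8" where
  "torus_exp x t u v = vector [
     v$1 + x * v$2,
     u * v$2,
     t * (2 * x * v$1 + x^2 * v$2 + v$3),
     t^2 * (3 * x^2 * v$1 + x^3 * v$2 + 3 * x * v$3 + v$4),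
     v$5,
     t * (v$6 - x * v$5),
     t * (v$7 + x * v$8),
     v$8]"

text \<open>Invariant coordinates composed with the product are invariant bilinear forms. Evaluated at basis
  vectors, these express the coordinates 1, 2, 6 and 7 of \<open>\<theta> v\<close> through $t$ and $x$; left
  multiplication by $e_2$, which sends $e_3$ to $2 e_1$ and $e_4$ to $e_3$, then gives the coordinates
  3 and 4.\<close>

lemma automorphism_is_torus_exp:
  fixes \<theta> :: "'a::comm_unital_ring ^ 8 \<Rightarrow> 'a ^ 8"
  assumes half: "(2::'a) * h2 = 1" and third: "(3::'a) * h3 = 1" and "W2_automorphism \<theta>"
  obtains x t u where "t * u = 1" "\<theta> = torus_exp x t u"
proof -
  note fixed = automorphism_fixes_coordinates[OF assms]
  have hom: "W2_mult (\<theta> v) (\<theta> w) $ k = \<theta> (W2_mult v w) $ k" for v w k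
    using W2_automorphismD(3)[OF assms(3)] by simp
  let ?e = "\<lambda>i. axis i 1 :: 'a ^ 8"
  have form5: "\<theta> v $ 1 * w$5 + \<theta> v $ 2 * \<theta> w $ 6 = v$1 * w$5 + v$2 * w$6" for v w
    using hom[of v w 5] by (simp add: fixed W2_mult_nth algebra_simps)
  have form8: "\<theta> v $ 2 * \<theta> w $ 7 - \<theta> v $ 1 * w$8 = v$2 * w$7 - v$1 * w$8" for v w
    using hom[of v w 8] by (simp add: fixed W2_mult_nth algebra_simps)
  \<comment> \<open>The matrix prescribed by the theorem has $t$ and $-tx$ at these positions of column 6,
     and the inverse of $t$ at the diagonal position in column 2.\<close>
  define t u x where "t = \<theta> (?e 6) $ 6" and "u = \<theta> (?e 2) $ 2" and "x = - (u * \<theta> (?e 5) $ 6)"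
  have tu: "t * u = 1"
    using form5[of "?e 2" "?e 6"] by (simp add: axis_def t_def u_def mult.commute)
  have ut: "u * (t * a) = a" "t * (u * a) = a" for a
    using tu by (simp_all only: mult.assoc[symmetric] mult.commute[of u t] mult_1)
  have solve: "a = t * b" if "u * a = b" for a b
    using that ut(2)[of a] by simp
  have c2: "\<theta> v $ 2 = u * v$2" for v
    using form5[of v "?e 6"] ut(1)[of "\<theta> v $ 2"] by (simp add: axis_def t_def mult.commute)
  have c1: "\<theta> v $ 1 = v$1 + x * v$2" for v
    using form5[of v "?e 5"] by (simp add: axis_def c2 x_def algebra_simps)
  have c6: "\<theta> v $ 6 = t * (v$6 - x * v$5)" for v
    using form5[of "?e 2" v] by (intro solve) (simp add: axis_def c1 c2 algebra_simps)
  have c7: "\<theta> v $ 7 = t * (v$7 + x * v$8)" for v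
    using form8[of "?e 2" v] by (intro solve) (simp add: axis_def c1 c2 algebra_simps)
  have first: "2 * (u * \<theta> v $ 3) = 2 * v$3 + 2 * (2 * (x * v$1)) + x^2 * v$2 + u * \<theta> (?e 2) $ 3 * v$2"
    for v
  proof -
    have "- (x * (v$1 + x * v$2)) + 2 * (u * \<theta> v $ 3) - \<theta> (?e 2) $ 3 * (u * v$2)
        = 2 * v$3 + x * (3 * v$1)"
      using hom[of "?e 2" v 1] by (simp add: axis_def W2_mult_nth fixed c1 c2 c6 c7)
    then have "2 * (u * \<theta> v $ 3)
        = (2 * v$3 + x * (3 * v$1)) + x * (v$1 + x * v$2) + \<theta> (?e 2) $ 3 * (u * v$2)"
      by (simp add: algebra_simps)
    also have "\<dots> = 2 * v$3 + 2 * (2 * (x * v$1)) + x^2 * v$2 + u * \<theta> (?e 2) $ 3 * v$2"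
      by (simp only: numeral_multiples distrib_left distrib_right power2_eq_square)
        (simp add: ac_simps)
    finally show ?thesis .
  qed
  \<comment> \<open>For $v = e_2$ the unknown $\theta(e_2)_3$ occurs on both sides, twice on the left and once on
     the right.\<close>
  have e2_3: "u * \<theta> (?e 2) $ 3 = x^2"
    using first[of "?e 2"] by (simp add: axis_def mult_2)
  have c3: "\<theta> v $ 3 = t * (2 * x * v$1 + x^2 * v$2 + v$3)" for v
  proof (rule solve, rule unit_mult_left_cancel[OF half])
    show "2 * (u * \<theta> v $ 3) = 2 * (2 * x * v$1 + x^2 * v$2 + v$3)"
      unfolding first e2_3 by (simp add: distrib_left mult_2 ac_simps)
  qed
  have c4: "\<theta> v $ 4 = t^2 * (3 * x^2 * v$1 + x^3 * v$2 + 3 * x * v$3 + v$4)" for v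
  proof -
    have "x * (t * (2 * x * v$1 + x^2 * v$2 + v$3)) + u * \<theta> v $ 4
          - 2 * (t * x^2 * (v$1 + x * v$2))
        = t * (2 * x * (2 * v$3) + x^2 * (3 * v$1) + v$4)"
      using hom[of "?e 2" v 3] by (simp add: axis_def W2_mult_nth fixed c1 c2 c3 c6 c7)
    then have "u * \<theta> v $ 4 = t * (2 * x * (2 * v$3) + x^2 * (3 * v$1) + v$4)
        + 2 * (t * x^2 * (v$1 + x * v$2)) - x * (t * (2 * x * v$1 + x^2 * v$2 + v$3))"
      by (simp only: eq_diff_eq diff_eq_eq add.commute)
    also have "\<dots> = t * (3 * x^2 * v$1 + x^3 * v$2 + 3 * x * v$3 + v$4)"
      by (simp only: numeral_multiples distrib_left distrib_right power2_eq_square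
          power3_eq_cube diff_eq_eq) (simp add: ac_simps)
    finally have "u * \<theta> v $ 4 = t * (3 * x^2 * v$1 + x^3 * v$2 + 3 * x * v$3 + v$4)" .
    from solve[OF this] show ?thesis by (simp add: power2_eq_square mult.assoc)
  qed
  show thesis
  proof (rule that[OF tu])
    show "\<theta> = torus_exp x t u"
      by (simp add: fun_eq_iff vec_eq_iff forall_8 torus_exp_def c1 c2 c3 c4 c6 c7 fixed)
  qed
qed

section \<open>Coordinate submodules\<close>

lemma mem_coord_submodule_iff:
  "v \<in> coord_submodule S \<longleftrightarrow> (\<forall>i. i \<notin> S \<longrightarrow> v $ i = 0)"
proof
  assume "v \<in> coord_submodule S"
  then show "\<forall>i. i \<notin> S \<longrightarrow> v $ i = 0"
    by (auto simp: coord_submodule_def axis_def intro!: sum.neutral)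
next
  assume outside: "\<forall>i. i \<notin> S \<longrightarrow> v $ i = 0"
  have "(\<Sum>i\<in>S. v $ i *s axis i 1) = (\<Sum>i\<in>UNIV. v $ i *s axis i 1)"
    by (rule sum.mono_neutral_left) (auto simp: outside vec_eq_iff)
  then have "v = (\<Sum>i\<in>S. v $ i *s axis i 1)"
    by (simp only: sum_unit_vectors)
  then show "v \<in> coord_submodule S"
    unfolding coord_submodule_def by blast
qed

lemma W2_left_ideal_coord_submodule:
  assumes "S \<in> {{1, 2, 3, 4}, {1, 2, 3, 4, 5, 6}, {5, 6}, {7, 8}}"
  shows "W2_left_ideal (coord_submodule S)"
  using assms
  by (auto simp: W2_left_ideal_def mem_coord_submodule_iff forall_8 W2_mult_nth)

lemma automorphism_coord_submodule_subset:
  fixes \<theta> :: "'a::comm_unital_ring ^ 8 \<Rightarrow> 'a ^ 8"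
  assumes "(2::'a) * h2 = 1" "(3::'a) * h3 = 1" "W2_automorphism \<theta>"
    and S: "S \<in> {{1, 2, 3, 4}, {1, 2, 3, 4, 5, 6}, {5, 6}, {7, 8}}"
  shows "\<theta> ` coord_submodule S \<subseteq> coord_submodule S"
proof -
  obtain x t u where "\<theta> = torus_exp x t u"
    by (rule automorphism_is_torus_exp[OF assms(1-3)])
  then show ?thesis
    using S by (auto simp: mem_coord_submodule_iff forall_8 torus_exp_def)
qed

theorem proposition30:
  fixes \<theta> :: "'a::comm_unital_ring ^ 8 \<Rightarrow> 'a ^ 8"
  assumes "\<exists>h::'a. 2 * h = 1" and "\<exists>h::'a. 3 * h = 1"
    and "W2_automorphism \<theta>"
  shows "(\<forall>S\<in>{{1, 2, 3, 4}, {1, 2, 3, 4, 5, 6}, {5, 6}, {7, 8}}.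
            W2_left_ideal (coord_submodule S :: ('a ^ 8) set) \<and>
            \<theta> ` coord_submodule S = coord_submodule S) \<and>
         (\<exists>x t t_inv :: 'a. t * t_inv = 1 \<and>
            row_matrix \<theta> = vector [
              vector [1, 0, 2 * t * x, 3 * t^2 * x^2, 0, 0, 0, 0],
              vector [x, t_inv, t * x^2, t^2 * x^3, 0, 0, 0, 0],
              vector [0, 0, t, 3 * t^2 * x, 0, 0, 0, 0],
              vector [0, 0, 0, t^2, 0, 0, 0, 0],
              vector [0, 0, 0, 0, 1, - (t * x), 0, 0],
              vector [0, 0, 0, 0, 0, t, 0, 0],
              vector [0, 0, 0, 0, 0, 0, t, 0],
              vector [0, 0, 0, 0, 0, 0, t * x, 1]])"
proof (intro conjI ballI)
  obtain h2 h3 :: 'a where units: "2 * h2 = 1" "3 * h3 = 1"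
    using assms(1,2) by blast
  fix S :: "8 set"
  assume S: "S \<in> {{1, 2, 3, 4}, {1, 2, 3, 4, 5, 6}, {5, 6}, {7, 8}}"
  show "W2_left_ideal (coord_submodule S :: ('a ^ 8) set)"
    by (rule W2_left_ideal_coord_submodule[OF S])
  show "\<theta> ` coord_submodule S = coord_submodule S"
  proof
    show "\<theta> ` coord_submodule S \<subseteq> coord_submodule S"
      using automorphism_coord_submodule_subset[OF units assms(3) S] .
    have "\<theta> ` inv \<theta> ` coord_submodule S \<subseteq> \<theta> ` coord_submodule S"
      using automorphism_coord_submodule_subset[OF units W2_automorphism_inv[OF assms(3)] S]
      by (rule image_mono)
    then show "coord_submodule S \<subseteq> \<theta> ` coord_submodule S"
      using W2_automorphismD(1)[OF assms(3)] by (simp add: image_f_inv_f bij_is_surj)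
  qed
next
  obtain h2 h3 :: 'a where units: "2 * h2 = 1" "3 * h3 = 1"
    using assms(1,2) by blast
  obtain x t u where tu: "t * u = 1" and \<theta>: "\<theta> = torus_exp x t u"
    by (rule automorphism_is_torus_exp[OF units assms(3)])
  have "row_matrix \<theta> = vector [
      vector [1, 0, 2 * t * x, 3 * t^2 * x^2, 0, 0, 0, 0],
      vector [x, u, t * x^2, t^2 * x^3, 0, 0, 0, 0],
      vector [0, 0, t, 3 * t^2 * x, 0, 0, 0, 0],
      vector [0, 0, 0, t^2, 0, 0, 0, 0],
      vector [0, 0, 0, 0, 1, - (t * x), 0, 0],
      vector [0, 0, 0, 0, 0, t, 0, 0],
      vector [0, 0, 0, 0, 0, 0, t, 0],
      vector [0, 0, 0, 0, 0, 0, t * x, 1]]"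
    unfolding vec_eq_iff forall_8 vector_8
    by (simp add: row_matrix_def \<theta> torus_exp_def axis_def ac_simps)
  with tu show "\<exists>x t t_inv :: 'a. t * t_inv = 1 \<and>
            row_matrix \<theta> = vector [
              vector [1, 0, 2 * t * x, 3 * t^2 * x^2, 0, 0, 0, 0],
              vector [x, t_inv, t * x^2, t^2 * x^3, 0, 0, 0, 0],
              vector [0, 0, t, 3 * t^2 * x, 0, 0, 0, 0],
              vector [0, 0, 0, t^2, 0, 0, 0, 0],
              vector [0, 0, 0, 0, 1, - (t * x), 0, 0],
              vector [0, 0, 0, 0, 0, t, 0, 0],
              vector [0, 0, 0, 0, 0, 0, t, 0],
              vector [0, 0, 0, 0, 0, 0, t * x, 1]]"
    by blast
qed

end
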